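(* Consider the linear model with deterministic $n\times p$ design matrix $\mathbf{X}$ ($p=p_n$) described in the context, with normally distributed errors $\varepsilon_i$, the projection $\boldsymbol{\theta}$ of $\boldsymbol{\beta}$ onto the row space of $\mathbf{X}$, and the ridge regression estimator $\hat{\boldsymbol{\theta}}=(\mathbf{X}'\mathbf{X}+h_n\mathbf{I}_p)^{-1}\mathbf{X}'\mathbf{y}$. Let $\lambda_{1n}$ be the smallest positive eigenvalue of $\mathbf{X}'\mathbf{X}$. Assume that 1. $\lambda_{1n}^{-1}=O(n^{-\eta})$, where $\eta\le1$ does not depend on $n$; 2. $\|\boldsymbol{\theta}\|=O(n^{\tau})$, where $\tau<\eta$ does not depend on $n$; 3. $p=O(e^{n^\nu})$, where $0<\nu<1$ does not depend on $n$. Let $a_n=C_1n^{-\alpha}$, where $C_1>0$ and $0<\alpha\le1/2$ do not depend on $n$ and $\alpha<(\eta-\nu-\tau)/3$. Let $u_n=1+(\log\log n)^{-1}$ and $h_n=C_2a_n^{-2}(\log\log n)^3\log(n\vee p)$, where $C_2>0$ is a constant. Then, for any constant $t>0$, $$P\bigl(\mathcal{M}_{\boldsymbol{\theta},a_nu_n}\subset\mathcal{M}_{\hat{\boldsymbol{\theta}},a_n}\subset\mathcal{M}_{\boldsymbol{\theta},a_n/u_n}\bigr)=1-O\bigl((n\vee p)^{-t}\bigr)$$ as $n\to\infty$.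
   Context: Model: for each $n$, $y_i=\mathbf{x}_i'\boldsymbol{\beta}+\varepsilon_i$, $i=1,\ldots,n$, where $\mathbf{x}_i\in\mathbb{R}^p$ are deterministic, $\boldsymbol{\beta}\in\mathbb{R}^p$ is unknown, and $\varepsilon_1,\ldots,\varepsilon_n$ are independent and identically distributed with mean $0$ and variance $\sigma^2$ (with distribution not depending on $n$). $\mathbf{y}=(y_1,\ldots,y_n)'$, and $\mathbf{X}$ is the (nonzero) $n\times p$ matrix with $i$th row $\mathbf{x}_i'$. The dimension $p=p_n$ is a function of $n$ and may exceed $n$; $\boldsymbol{\beta},\mathbf{y},\mathbf{x}_i,\mathbf{X},\boldsymbol{\theta}$ form triangular arrays, with the index $n$ suppressed. Limits and $O(\cdot)$ are as $n\to\infty$ (with $n$ large enough that $\log\log n>0$). Projection: $\boldsymbol{\theta}$ is the orthogonal projection of $\boldsymbol{\beta}$ onto the row space of $\mathbf{X}$; equivalently, if $\mathbf{X}=\mathbf{P}\mathbf{D}\mathbf{Q}'$ is the singular value decomposition with $\mathbf{P}'\mathbf{P}=\mathbf{Q}'\mathbf{Q}=\mathbf{I}_{r}$, $r$ the rank of $\mathbf{X}$ and $\mathbf{D}$ an $r\times r$ nonsingular diagonal matrix, then $\boldsymbol{\theta}=\mathbf{Q}\mathbf{Q}'\boldsymbol{\beta}$. Notation: for a vector $\boldsymbol{\xi}$ and $c>0$, $\mathcal{M}_{\boldsymbol{\xi},c}$ denotes the set of indices of components of $\boldsymbol{\xi}$ whose absolute values are larger than $c$ (so $\mathcal{M}_{\hat{\boldsymbol{\theta}},a_n}$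 is the set of indices of nonzero components after thresholding $\hat{\boldsymbol{\theta}}$ at $a_n$). $n\vee p=\max(n,p)$; $\|\cdot\|$ is the Euclidean norm; $'$ is transpose; $\mathbf{I}_a$ is the identity matrix of order $a$. *)

theory Defs
  imports
    "HOL-Probability.Probability"
    "Jordan_Normal_Form.Gauss_Jordan_Elimination"
    "Jordan_Normal_Form.Char_Poly"
    "Jordan_Normal_Form.VS_Connect"
begin

unbundle no vec_syntax and no inner_syntax

text \<open>
  The dimensions vary with the sample size, so vectors and matrices are those of
  Jordan_Normal_Form, whose dimensions are terms; indices start at 0.
\<close>

definition euclidean_norm :: "real vec \<Rightarrow> real" where
  "euclidean_norm v = sqrt (v \<bullet> v)"

definition is_orthogonal_projection :: "real vec set \<Rightarrow> real vec \<Rightarrow> real vec \<Rightarrow> bool" where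
  "is_orthogonal_projection S v w \<longleftrightarrow> w \<in> S \<and> (\<forall>u\<in>S. (v - w) \<bullet> u = 0)"

definition row_space_of :: "real mat \<Rightarrow> real vec set" where
  "row_space_of X = vec_space.row_space (dim_col X) X"

text \<open>Used only for \<open>X\<^sup>T * X\<close> with \<open>X \<noteq> 0\<close>, where the set is finite and nonempty.\<close>

definition min_pos_eigenvalue :: "real mat \<Rightarrow> real" where
  "min_pos_eigenvalue A = Min {k. eigenvalue A k \<and> k > 0}"

text \<open>
  For \<open>h > 0\<close> the matrix \<open>X\<^sup>T * X + h I\<close> is positive definite, so that its
  \<^const>\<open>mat_inverse\<close> is not \<^const>\<open>None\<close>.
\<close>

definition ridge_estimator :: "real mat \<Rightarrow> real \<Rightarrow> real vec \<Rightarrow> real vec" where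
  "ridge_estimator X h y =
     the (mat_inverse (X\<^sup>T * X + h \<cdot>\<^sub>m 1\<^sub>m (dim_col X))) *\<^sub>v (X\<^sup>T *\<^sub>v y)"

definition large_components :: "real vec \<Rightarrow> real \<Rightarrow> nat set" where
  "large_components v c = {i. i < dim_vec v \<and> \<bar>v $ i\<bar> > c}"

end

theory Submission
  imports Defs "HOL-Real_Asymp.Real_Asymp"
begin

text \<open>
  Write \<open>A = X\<^sup>T X + h I\<close>. Since \<open>X \<beta> = X \<theta>\<close>, the estimator splits as
  \<open>\<theta>hat = \<theta> - h A\<^sup>-\<^sup>1 \<theta> + A\<^sup>-\<^sup>1 X\<^sup>T \<epsilon>\<close>.
  The bias vector \<open>b = A\<^sup>-\<^sup>1 \<theta>\<close> is orthogonal to the kernel of \<open>X\<close>, where the quadratic form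
  of \<open>X\<^sup>T X\<close> is at least \<open>\<lambda> \<parallel>b\<parallel>\<^sup>2\<close>; pairing \<open>A b = \<theta>\<close> with \<open>b\<close> gives
  \<open>\<parallel>b\<parallel> \<le> \<parallel>\<theta>\<parallel> / \<lambda>\<close>. This replaces the singular value decomposition.
  The rows of \<open>A\<^sup>-\<^sup>1 X\<^sup>T\<close> have squared norm at most \<open>1 / h\<close>, so each noise component has a
  Gaussian tail with variance proxy \<open>\<sigma>\<^sup>2 / h\<close>. With \<open>L = ln (ln n)\<close>, the inclusions hold as soon
  as every component of \<open>\<theta>hat - \<theta>\<close> is below \<open>a / (L + 1) = a - a / u\<close>. Half of this budget covers
  the bias because \<open>3 \<alpha> < \<eta> - \<nu> - \<tau>\<close>; the other half covers the noise, with exponent of order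
  \<open>L ln (max n p)\<close>, which beats the union bound over \<open>p\<close> components and any power \<open>t\<close>.
\<close>

section \<open>Gaussian tails of linear combinations of the errors\<close>

text \<open>Completing the square: tilting the centred density by \<open>exp (s * x)\<close> gives a
  constant times the density with mean \<open>s * \<sigma>\<^sup>2\<close>, which integrates to
  1.\<close>

lemma normal_exp_moment:
  fixes s \<sigma> :: real
  assumes "\<sigma> > 0"
  shows "integrable lborel (\<lambda>x. normal_density 0 \<sigma> x * exp (s * x))"
    and "(\<integral>x. normal_density 0 \<sigma> x * exp (s * x) \<partial>lborel) = exp (s\<^sup>2 * \<sigma>\<^sup>2 / 2)"
proof -
  have shift: "normal_density 0 \<sigma> x * exp (s * x) =
      exp (s\<^sup>2 * \<sigma>\<^sup>2 / 2) * normal_density (s * \<sigma>\<^sup>2) \<sigma> x" for x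
  proof -
    have "- (x - 0)\<^sup>2 / (2 * \<sigma>\<^sup>2) + s * x =
        s\<^sup>2 * \<sigma>\<^sup>2 / 2 + - (x - s * \<sigma>\<^sup>2)\<^sup>2 / (2 * \<sigma>\<^sup>2)"
      using assms by (simp add: field_simps power2_eq_square)
    then have "exp (- (x - 0)\<^sup>2 / (2 * \<sigma>\<^sup>2)) * exp (s * x) =
        exp (s\<^sup>2 * \<sigma>\<^sup>2 / 2) * exp (- (x - s * \<sigma>\<^sup>2)\<^sup>2 / (2 * \<sigma>\<^sup>2))"
      by (metis exp_add)
    then show ?thesis
      unfolding normal_density_def by simp
  qed
  show "integrable lborel (\<lambda>x. normal_density 0 \<sigma> x * exp (s * x))"
    unfolding shift using assms by (intro integrable_mult_right integrable_normal_density)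
  show "(\<integral>x. normal_density 0 \<sigma> x * exp (s * x) \<partial>lborel) = exp (s\<^sup>2 * \<sigma>\<^sup>2 / 2)"
    unfolding shift using assms by simp
qed

text \<open>Chernoff's method: Markov's inequality for the exponential of the sum, whose expectation
  factorizes by independence into the normal moments above.\<close>

lemma (in prob_space) normal_combination_upper_tail:
  fixes \<epsilon> :: "nat \<Rightarrow> 'a \<Rightarrow> real" and c :: "nat \<Rightarrow> real"
  assumes \<sigma>: "\<sigma> > 0"
    and normal: "\<And>i. i < n \<Longrightarrow> distributed M lborel (\<epsilon> i) (normal_density 0 \<sigma>)"
    and indep: "indep_vars (\<lambda>_. borel) \<epsilon> {..<n}"
    and V: "V > 0" "(\<Sum>i<n. (c i)\<^sup>2) \<le> V"
    and d: "d > 0"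
  shows "measure M {\<omega> \<in> space M. (\<Sum>i<n. c i * \<epsilon> i \<omega>) \<ge> d} \<le> exp (- d\<^sup>2 / (2 * \<sigma>\<^sup>2 * V))"
proof -
  \<comment> \<open>This \<open>s\<close> minimizes the exponent
    \<open>s\<^sup>2 * \<sigma>\<^sup>2 / 2 * V - s * d\<close> obtained at the end.\<close>
  define s where "s = d / (\<sigma>\<^sup>2 * V)"
  have s: "s > 0" unfolding s_def using \<sigma> V d by simp
  define E where "E i \<omega> = exp (s * c i * \<epsilon> i \<omega>)" for i \<omega>
  have indepE: "indep_vars (\<lambda>_. borel) E {..<n}"
    unfolding E_def by (rule indep_vars_compose2[OF indep]) measurable
  have intE: "integrable M (E i)" and expE: "expectation (E i) = exp ((s * c i)\<^sup>2 * \<sigma>\<^sup>2 / 2)"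
    if "i < n" for i
    using normal_exp_moment[OF \<sigma>, of "s * c i"]
      distributed_integrable[OF normal[OF that], of "\<lambda>x. exp (s * c i * x)"]
      distributed_integral[OF normal[OF that], of "\<lambda>x. exp (s * c i * x)"]
    by (simp_all add: E_def[abs_def])
  have sumE: "(\<Prod>i<n. E i \<omega>) = exp (s * (\<Sum>i<n. c i * \<epsilon> i \<omega>))" for \<omega>
    by (simp add: E_def exp_sum sum_distrib_left mult.assoc)
  have "expectation (\<lambda>\<omega>. \<Prod>i<n. E i \<omega>) = (\<Prod>i<n. exp ((s * c i)\<^sup>2 * \<sigma>\<^sup>2 / 2))"
    using indep_vars_lebesgue_integral[OF _ indepE] intE expE by simp
  also have "\<dots> = exp (s\<^sup>2 * \<sigma>\<^sup>2 / 2 * (\<Sum>i<n. (c i)\<^sup>2))"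
    by (simp add: exp_sum[symmetric] sum_distrib_left power_mult_distrib mult_ac)
  also have "\<dots> \<le> exp (s\<^sup>2 * \<sigma>\<^sup>2 / 2 * V)"
    using V by (simp add: mult_left_mono)
  finally have moment: "expectation (\<lambda>\<omega>. \<Prod>i<n. E i \<omega>) \<le> exp (s\<^sup>2 * \<sigma>\<^sup>2 / 2 * V)" .
  have "{\<omega> \<in> space M. (\<Sum>i<n. c i * \<epsilon> i \<omega>) \<ge> d} =
      {\<omega> \<in> space M. (\<Prod>i<n. E i \<omega>) \<ge> exp (s * d)}"
    using s by (simp add: sumE)
  also have "measure M \<dots> \<le> expectation (\<lambda>\<omega>. \<Prod>i<n. E i \<omega>) / exp (s * d)"
    by (rule integral_Markov_inequality_measure[where A = "{}"])
       (use indep_vars_integrable[OF _ indepE] intE in \<open>auto simp: sumE\<close>)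
  also have "\<dots> \<le> exp (s\<^sup>2 * \<sigma>\<^sup>2 / 2 * V) / exp (s * d)"
    using moment by (simp add: divide_right_mono)
  also have "\<dots> = exp (s\<^sup>2 * \<sigma>\<^sup>2 / 2 * V - s * d)"
    by (simp add: exp_diff)
  also have "s\<^sup>2 * \<sigma>\<^sup>2 / 2 * V - s * d = - d\<^sup>2 / (2 * \<sigma>\<^sup>2 * V)"
    unfolding s_def using \<sigma> V by (simp add: field_simps power2_eq_square)
  finally show ?thesis .
qed

lemma (in prob_space) normal_combination_tail:
  fixes \<epsilon> :: "nat \<Rightarrow> 'a \<Rightarrow> real" and c :: "nat \<Rightarrow> real"
  assumes \<sigma>: "\<sigma> > 0"
    and normal: "\<And>i. i < n \<Longrightarrow> distributed M lborel (\<epsilon> i) (normal_density 0 \<sigma>)"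
    and indep: "indep_vars (\<lambda>_. borel) \<epsilon> {..<n}"
    and V: "V > 0" "(\<Sum>i<n. (c i)\<^sup>2) \<le> V"
    and d: "d > 0"
  shows "measure M {\<omega> \<in> space M. \<bar>\<Sum>i<n. c i * \<epsilon> i \<omega>\<bar> \<ge> d} \<le> 2 * exp (- d\<^sup>2 / (2 * \<sigma>\<^sup>2 * V))"
proof -
  have rv [measurable]: "\<epsilon> i \<in> borel_measurable M" if "i \<in> {..<n}" for i
    using distributed_measurable[OF normal] that by simp
  have "measure M {\<omega> \<in> space M. \<bar>\<Sum>i<n. c i * \<epsilon> i \<omega>\<bar> \<ge> d}
      = measure M ({\<omega> \<in> space M. (\<Sum>i<n. c i * \<epsilon> i \<omega>) \<ge> d} \<union>
          {\<omega> \<in> space M. (\<Sum>i<n. - c i * \<epsilon> i \<omega>) \<ge> d})"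
    by (rule arg_cong[where f = "measure M"]) (auto simp: sum_negf)
  also have "\<dots> \<le> measure M {\<omega> \<in> space M. (\<Sum>i<n. c i * \<epsilon> i \<omega>) \<ge> d} +
          measure M {\<omega> \<in> space M. (\<Sum>i<n. - c i * \<epsilon> i \<omega>) \<ge> d}"
    by (rule measure_Un_le) measurable
  also have "\<dots> \<le> exp (- d\<^sup>2 / (2 * \<sigma>\<^sup>2 * V)) + exp (- d\<^sup>2 / (2 * \<sigma>\<^sup>2 * V))"
    by (intro add_mono normal_combination_upper_tail[OF \<sigma> normal indep _ _ d]) (use V in auto)
  finally show ?thesis by simp
qed

section \<open>The quadratic form of \<open>X\<^sup>T * X\<close> and its smallest positive
  eigenvalue\<close>

lemma scalar_prod_self_nonneg: "0 \<le> (v :: real vec) \<bullet> v"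
  by (simp add: scalar_prod_def sum_nonneg)

lemma scalar_prod_self_eq_0: "(v :: real vec) \<in> carrier_vec p \<Longrightarrow> v \<bullet> v = 0 \<longleftrightarrow> v = 0\<^sub>v p"
  using conjugate_square_eq_0_vec[of v p] by simp

lemma component_squared_le_scalar_prod_self:
  assumes "i < dim_vec (v :: real vec)"
  shows "(v $ i)\<^sup>2 \<le> v \<bullet> v"
  using assms member_le_sum[of i "{0..<dim_vec v}" "\<lambda>i. (v $ i)\<^sup>2"]
  by (simp add: scalar_prod_def power2_eq_square)

text \<open>Tychonoff's theorem for a product of compact sets. Pinning the coordinates from
  \<open>p\<close> on to 0 represents a cube of dimension \<open>p\<close> inside the full function
  space.\<close>

lemma compact_coordinate_cube: "compact {f :: nat \<Rightarrow> real. \<forall>i. f i \<in> (if i < p then {-1..1} else {0})}"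
proof -
  have "compactin euclidean (PiE UNIV (\<lambda>i. if i < p then {-1..1::real} else {0}))"
    unfolding euclidean_product_topology[symmetric] compactin_PiE by simp
  moreover have "PiE UNIV (\<lambda>i. if i < p then {-1..1::real} else {0}) =
      {f. \<forall>i. f i \<in> (if i < p then {-1..1} else {0})}"
    by (auto simp: PiE_def Pi_def)
  ultimately show ?thesis by simp
qed

text \<open>
  The type \<^typ>\<open>real vec\<close> carries no topology, so compactness of the sphere is used
  through \<^typ>\<open>nat \<Rightarrow> real\<close> with its product topology.
\<close>

lemma quadratic_form_attains_min_on_sphere:
  fixes X :: "real mat"
  assumes X: "X \<in> carrier_mat n p" and K: "K \<subseteq> carrier_vec p"
    and w: "w \<in> carrier_vec p" "w \<noteq> 0\<^sub>v p" "\<And>v. v \<in> K \<Longrightarrow> v \<bullet> w = 0"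
  obtains u where "u \<in> carrier_vec p" "u \<bullet> u = 1" "\<And>v. v \<in> K \<Longrightarrow> v \<bullet> u = 0"
    "\<And>z. z \<in> carrier_vec p \<Longrightarrow> (\<And>v. v \<in> K \<Longrightarrow> v \<bullet> z = 0) \<Longrightarrow>
       ((X *\<^sub>v u) \<bullet> (X *\<^sub>v u)) * (z \<bullet> z) \<le> (X *\<^sub>v z) \<bullet> (X *\<^sub>v z)"
proof -
  \<comment> \<open>\<open>S\<close> is the unit sphere of the orthogonal complement of
    \<open>K\<close>. The cube excludes no unit vector; it supplies compactness, as the other two
    conditions are only closed.\<close>
  define S where "S = {f :: nat \<Rightarrow> real. \<forall>i. f i \<in> (if i < p then {-1..1} else {0})} \<inter>
    {f. vec p f \<bullet> vec p f = 1} \<inter> (\<Inter>v\<in>K. {f. v \<bullet> vec p f = 0})"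
  define q where "q f = (X *\<^sub>v vec p f) \<bullet> (X *\<^sub>v vec p f)" for f :: "nat \<Rightarrow> real"
  have coord [continuous_intros]: "continuous_on A (\<lambda>f :: nat \<Rightarrow> real. f i)" for A i
    by (rule continuous_on_subset[OF continuous_on_product_coordinates]) simp
  have cont_inner: "continuous_on UNIV (\<lambda>f :: nat \<Rightarrow> real. v \<bullet> vec p f)" for v
    by (simp add: scalar_prod_def) (intro continuous_intros)
  have cont_norm: "continuous_on UNIV (\<lambda>f :: nat \<Rightarrow> real. vec p f \<bullet> vec p f)"
    by (simp add: scalar_prod_def) (intro continuous_intros)
  have cont_q: "continuous_on UNIV q"
    unfolding q_def by (simp add: scalar_prod_def) (intro continuous_intros)
  have "closed {f :: nat \<Rightarrow> real. vec p f \<bullet> vec p f = 1}"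
    using continuous_closed_preimage_constant[OF cont_norm, of 1] by simp
  moreover have "closed (\<Inter>v\<in>K. {f :: nat \<Rightarrow> real. v \<bullet> vec p f = 0})"
    using continuous_closed_preimage_constant[OF cont_inner closed_UNIV] by (intro closed_INT) simp
  ultimately have compact: "compact S"
    unfolding S_def by (intro compact_Int_closed compact_coordinate_cube)
  \<comment> \<open>Both sides of the claim are quadratic in \<open>z\<close>, so it is enough to
    compare on \<open>S\<close>, where each nonzero admissible \<open>z\<close> lands after division
    by its norm.\<close>
  have normalized: "(\<lambda>i. if i < p then z $ i / sqrt (z \<bullet> z) else 0) \<in> S \<and>
      q (\<lambda>i. if i < p then z $ i / sqrt (z \<bullet> z) else 0) * (z \<bullet> z) = (X *\<^sub>v z) \<bullet> (X *\<^sub>v z)"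
    if z: "z \<in> carrier_vec p" "z \<noteq> 0\<^sub>v p" "\<And>v. v \<in> K \<Longrightarrow> v \<bullet> z = 0" for z
  proof -
    define r where "r = sqrt (z \<bullet> z)"
    define f where "f = (\<lambda>i. if i < p then z $ i / r else 0)"
    have zz: "z \<bullet> z > 0"
      using conjugate_square_greater_0_vec[of z p] z by simp
    then have r: "r > 0" "r * r = z \<bullet> z" unfolding r_def by simp_all
    have f: "vec p f = inverse r \<cdot>\<^sub>v z"
      using z(1) by (intro eq_vecI) (auto simp: f_def divide_inverse)
    have rr: "inverse r * (inverse r * (z \<bullet> z)) = 1"
      using r zz by (simp add: field_simps)
    have "- 1 \<le> f i \<and> f i \<le> 1" if "i < p" for i
    proof -
      have "(z $ i)\<^sup>2 \<le> z \<bullet> z"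
        using component_squared_le_scalar_prod_self z(1) that by simp
      then have "\<bar>z $ i\<bar> \<le> r"
        unfolding r_def by (simp add: real_le_rsqrt)
      then show ?thesis using r(1) that by (simp add: f_def abs_le_iff field_simps)
    qed
    then have "f i \<in> (if i < p then {-1..1} else {0})" for i
      by (simp add: f_def)
    moreover have "vec p f \<bullet> vec p f = 1"
      unfolding f using z(1) r zz by (simp add: field_simps)
    moreover have "v \<bullet> vec p f = 0" if "v \<in> K" for v
      unfolding f using z K that by (subst scalar_prod_smult_distrib[of _ p]) auto
    ultimately have "f \<in> S"
      unfolding S_def by blast
    moreover have "q f * (z \<bullet> z) = (X *\<^sub>v z) \<bullet> (X *\<^sub>v z)"
      unfolding q_def f using X z(1) rr by (simp add: mult_mat_vec[OF X] mult_ac)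
    ultimately show ?thesis unfolding f_def r_def by simp
  qed
  \<comment> \<open>The vector \<open>w\<close> ensures that the complement of \<open>K\<close> is
    not trivial, so that a minimum exists.\<close>
  have "S \<noteq> {}" using normalized[OF w] by auto
  then obtain g where g: "g \<in> S" and min: "\<And>f. f \<in> S \<Longrightarrow> q g \<le> q f"
    using continuous_attains_inf[OF compact, of q] continuous_on_subset[OF cont_q] by auto
  show thesis
  proof (rule that)
    show "vec p g \<in> carrier_vec p" by simp
    show "vec p g \<bullet> vec p g = 1" and "\<And>v. v \<in> K \<Longrightarrow> v \<bullet> vec p g = 0"
      using g unfolding S_def by auto
    fix z assume z: "z \<in> carrier_vec p" "\<And>v. v \<in> K \<Longrightarrow> v \<bullet> z = 0"
    show "((X *\<^sub>v vec p g) \<bullet> (X *\<^sub>v vec p g)) * (z \<bullet> z) \<le> (X *\<^sub>v z) \<bullet> (X *\<^sub>v z)"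
    proof (cases "z = 0\<^sub>v p")
      case True
      then show ?thesis by (simp add: scalar_prod_self_nonneg)
    next
      case False
      show ?thesis
        using normalized[OF z(1) False z(2)] min scalar_prod_self_nonneg[of z]
        unfolding q_def[symmetric] by (metis mult_right_mono)
    qed
  qed
qed

lemma scalar_prod_le_euclidean_norm:
  assumes "dim_vec v = dim_vec w"
  shows "v \<bullet> w \<le> euclidean_norm v * euclidean_norm w"
proof -
  have "(v \<bullet> w)\<^sup>2 \<le> (v \<bullet> v) * (w \<bullet> w)"
    using Cauchy_Schwarz_ineq_sum[of "($) v" "($) w" "{0..<dim_vec w}"] assms
    by (simp add: scalar_prod_def power2_eq_square)
  then show ?thesis
    unfolding euclidean_norm_def real_sqrt_mult[symmetric] by (rule real_le_rsqrt)
qed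

lemma gram_scalar_prod:
  assumes X: "(X :: real mat) \<in> carrier_mat n p" and v: "v \<in> carrier_vec p" and z: "z \<in> carrier_vec p"
  shows "((X\<^sup>T * X) *\<^sub>v v) \<bullet> z = (X *\<^sub>v v) \<bullet> (X *\<^sub>v z)"
  using assms transpose_vec_mult_scalar[OF X z, of "X *\<^sub>v v"]
  by (simp add: assoc_mult_mat_vec[of _ p n _ p])

text \<open>Near 0 the linear term dominates, so a nonzero \<open>R\<close> would make the
  expression negative for small \<open>s\<close> of the opposite sign.\<close>

lemma first_order_term_zero:
  fixes R c :: real
  assumes nonneg: "\<And>s. 0 \<le> 2 * s * R + s\<^sup>2 * c"
  shows "R = 0"
proof (rule ccontr)
  assume R: "R \<noteq> 0"
  \<comment> \<open>Being larger than both 0 and \<open>c\<close>, \<open>d\<close> makes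
    \<open>c - 2 * d\<close> negative, which decides the sign at \<open>s = - R / d\<close>.\<close>
  define d where "d = \<bar>c\<bar> + 1"
  have d: "d > 0" "c < d" unfolding d_def by auto
  have "2 * (- R / d) * R + (- R / d)\<^sup>2 * c = R\<^sup>2 * (c - 2 * d) / d\<^sup>2"
    using d by (simp add: field_simps power2_eq_square)
  also have "\<dots> < 0"
    using R d by (simp add: divide_neg_pos mult_pos_neg)
  finally show False using nonneg[of "- R / d"] by simp
qed

text \<open>Variational argument: the minimum \<open>\<mu>\<close> of the form on the unit sphere of
  the complement of the kernel is itself a positive eigenvalue, hence at least the smallest one, and
  by homogeneity it bounds the form at \<open>w\<close> from below.\<close>

lemma min_pos_eigenvalue_gram:
  fixes X :: "real mat"
  assumes X: "X \<in> carrier_mat n p"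
    and w: "w \<in> carrier_vec p" "w \<noteq> 0\<^sub>v p"
    and w_ker: "\<And>v. v \<in> carrier_vec p \<Longrightarrow> X *\<^sub>v v = 0\<^sub>v n \<Longrightarrow> v \<bullet> w = 0"
  shows "0 < min_pos_eigenvalue (X\<^sup>T * X)"
    and "min_pos_eigenvalue (X\<^sup>T * X) * (w \<bullet> w) \<le> (X *\<^sub>v w) \<bullet> (X *\<^sub>v w)"
proof -
  define G where "G = X\<^sup>T * X"
  define K where "K = {v \<in> carrier_vec p. X *\<^sub>v v = 0\<^sub>v n}"
  have G: "G \<in> carrier_mat p p" unfolding G_def using X by simp
  have Gv: "(G *\<^sub>v v) \<bullet> z = (X *\<^sub>v v) \<bullet> (X *\<^sub>v z)" if "v \<in> carrier_vec p" "z \<in> carrier_vec p" for v z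
    unfolding G_def by (rule gram_scalar_prod[OF X that])
  obtain u where u: "u \<in> carrier_vec p" "u \<bullet> u = 1" "\<And>v. v \<in> K \<Longrightarrow> v \<bullet> u = 0"
    and min: "\<And>z. z \<in> carrier_vec p \<Longrightarrow> (\<And>v. v \<in> K \<Longrightarrow> v \<bullet> z = 0) \<Longrightarrow>
       ((X *\<^sub>v u) \<bullet> (X *\<^sub>v u)) * (z \<bullet> z) \<le> (X *\<^sub>v z) \<bullet> (X *\<^sub>v z)"
    using quadratic_form_attains_min_on_sphere[OF X _ w, of K] w_ker unfolding K_def by auto
  define \<mu> where "\<mu> = (X *\<^sub>v u) \<bullet> (X *\<^sub>v u)"
  define r where "r = G *\<^sub>v u - \<mu> \<cdot>\<^sub>v u"
  have Gu: "G *\<^sub>v u \<in> carrier_vec p" using G u(1) by simp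
  have r: "r \<in> carrier_vec p" unfolding r_def using Gu u(1) by simp
  have r_prod: "z \<bullet> r = (X *\<^sub>v u) \<bullet> (X *\<^sub>v z) - \<mu> * (u \<bullet> z)" if z: "z \<in> carrier_vec p" for z
  proof -
    have "z \<bullet> r = z \<bullet> (G *\<^sub>v u) - z \<bullet> (\<mu> \<cdot>\<^sub>v u)"
      unfolding r_def using Gu u(1) z by (intro scalar_prod_minus_distrib[of _ p]) auto
    then show ?thesis
      using Gv[OF u(1) z] Gu u(1) z comm_scalar_prod[OF z Gu] comm_scalar_prod[OF z u(1)] by simp
  qed
  \<comment> \<open>The residual stays in the complement of the kernel, so \<open>u + s r\<close>
    remains a legitimate competitor in the minimization.\<close>
  have r_ker: "v \<bullet> r = 0" if "v \<in> K" for v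
  proof -
    have v: "v \<in> carrier_vec p" "X *\<^sub>v v = 0\<^sub>v n" using that unfolding K_def by auto
    show ?thesis
      using r_prod[OF v(1)] u(3)[OF that] comm_scalar_prod[OF v(1) u(1)] v(2) X u(1) by simp
  qed
  \<comment> \<open>Perturbing the minimizer \<open>u\<close> in the direction of the residual \<open>r\<close> changes the form to first
    order by \<open>2 s (r \<bullet> r)\<close>, so the residual vanishes and \<open>u\<close> is an eigenvector.\<close>
  have "r \<bullet> r = 0"
  proof (rule first_order_term_zero)
    fix s :: real
    define z where "z = u + s \<cdot>\<^sub>v r"
    have sr: "s \<cdot>\<^sub>v r \<in> carrier_vec p" using r by simp
    have z: "z \<in> carrier_vec p" unfolding z_def using u(1) r by simp
    have expand: "(a + s \<cdot>\<^sub>v b) \<bullet> (a + s \<cdot>\<^sub>v b) = a \<bullet> a + 2 * s * (a \<bullet> b) + s\<^sup>2 * (b \<bullet> b)"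
      if a: "a \<in> carrier_vec m" and b: "b \<in> carrier_vec m" for a b :: "real vec" and m
    proof -
      have "s \<cdot>\<^sub>v b \<in> carrier_vec m" using b by simp
      then show ?thesis
        using a b comm_scalar_prod[OF b a]
        by (simp add: add_scalar_prod_distrib[of _ m] scalar_prod_add_distrib[of _ m]
            power2_eq_square algebra_simps)
    qed
    have "v \<bullet> z = 0" if "v \<in> K" for v
    proof -
      have v: "v \<in> carrier_vec p" using that unfolding K_def by auto
      show ?thesis
        unfolding z_def scalar_prod_add_distrib[OF v u(1) sr]
        using u(3)[OF that] r_ker[OF that] v r by simp
    qed
    then have "\<mu> * (z \<bullet> z) \<le> (X *\<^sub>v z) \<bullet> (X *\<^sub>v z)"
      unfolding \<mu>_def using min z by blast
    moreover have "X *\<^sub>v z = X *\<^sub>v u + s \<cdot>\<^sub>v (X *\<^sub>v r)"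
      unfolding z_def using X u(1) r by (simp add: mult_add_distrib_mat_vec[OF X] mult_mat_vec[OF X])
    moreover have "X *\<^sub>v u \<in> carrier_vec n" "X *\<^sub>v r \<in> carrier_vec n" using X u(1) r by auto
    ultimately have "\<mu> * (u \<bullet> u + 2 * s * (u \<bullet> r) + s\<^sup>2 * (r \<bullet> r)) \<le>
        \<mu> + 2 * s * ((X *\<^sub>v u) \<bullet> (X *\<^sub>v r)) + s\<^sup>2 * ((X *\<^sub>v r) \<bullet> (X *\<^sub>v r))"
      using expand[OF u(1) r] expand[of "X *\<^sub>v u" n "X *\<^sub>v r"] unfolding z_def[symmetric] \<mu>_def[symmetric]
      by metis
    then show "0 \<le> 2 * s * (r \<bullet> r) + s\<^sup>2 * ((X *\<^sub>v r) \<bullet> (X *\<^sub>v r) - \<mu> * (r \<bullet> r))"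
      unfolding r_prod[OF r] using u(2) r_prod[OF r] by (simp add: algebra_simps)
  qed
  then have "r = 0\<^sub>v p" using scalar_prod_self_eq_0[OF r] by simp
  then have zero: "(G *\<^sub>v u - \<mu> \<cdot>\<^sub>v u) $ i = 0" if "i < p" for i
    unfolding r_def using that by simp
  have "G *\<^sub>v u = \<mu> \<cdot>\<^sub>v u"
    using zero Gu u(1) G by (intro eq_vecI) auto
  moreover have "u \<noteq> 0\<^sub>v p" using u(2) by auto
  ultimately have eig: "eigenvalue G \<mu>"
    unfolding eigenvalue_def eigenvector_def using G u(1) by auto
  \<comment> \<open>Otherwise \<open>u\<close> would lie in the kernel and, being orthogonal to it,
    be orthogonal to itself.\<close>
  have "\<mu> \<noteq> 0"
  proof
    assume "\<mu> = 0"
    then have "X *\<^sub>v u = 0\<^sub>v n"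
      unfolding \<mu>_def using scalar_prod_self_eq_0[of "X *\<^sub>v u" n] X u(1) by simp
    then have "u \<bullet> u = 0" using u(1,3) unfolding K_def by simp
    then show False using u(2) by simp
  qed
  then have pos: "\<mu> > 0" using scalar_prod_self_nonneg[of "X *\<^sub>v u"] unfolding \<mu>_def by simp
  \<comment> \<open>\<open>Min\<close> needs a finite nonempty set: eigenvalues are roots of the
    nonzero characteristic polynomial, and \<open>\<mu>\<close> is a member.\<close>
  define E where "E = {k. eigenvalue G k \<and> k > 0}"
  have "char_poly G \<noteq> 0" using degree_monic_char_poly[OF G] by auto
  then have "finite E"
    unfolding E_def eigenvalue_root_char_poly[OF G] by (intro finite_subset[OF _ poly_roots_finite]) auto
  moreover have "\<mu> \<in> E" unfolding E_def using eig pos by simp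
  ultimately have "Min E \<in> E" "Min E \<le> \<mu>" by (auto intro: Min_in)
  moreover have "min_pos_eigenvalue (X\<^sup>T * X) = Min E"
    unfolding min_pos_eigenvalue_def E_def G_def ..
  ultimately have pos_min: "0 < min_pos_eigenvalue (X\<^sup>T * X)" and le: "min_pos_eigenvalue (X\<^sup>T * X) \<le> \<mu>"
    unfolding E_def by auto
  show "0 < min_pos_eigenvalue (X\<^sup>T * X)" by (rule pos_min)
  have "min_pos_eigenvalue (X\<^sup>T * X) * (w \<bullet> w) \<le> \<mu> * (w \<bullet> w)"
    using le scalar_prod_self_nonneg by (rule mult_right_mono)
  also have "\<dots> \<le> (X *\<^sub>v w) \<bullet> (X *\<^sub>v w)"
    unfolding \<mu>_def using min[OF w(1)] w_ker unfolding K_def by simp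
  finally show "min_pos_eigenvalue (X\<^sup>T * X) * (w \<bullet> w) \<le> (X *\<^sub>v w) \<bullet> (X *\<^sub>v w)" .
qed

section \<open>The ridge matrix: inverse, noise coefficients, bias and decomposition of the
  estimator\<close>

lemma ridge_matrix_mult_vec:
  fixes X :: "real mat"
  assumes X: "X \<in> carrier_mat n p" and v: "v \<in> carrier_vec p"
  shows "(X\<^sup>T * X + h \<cdot>\<^sub>m 1\<^sub>m p) *\<^sub>v v = (X\<^sup>T * X) *\<^sub>v v + h \<cdot>\<^sub>v v"
proof -
  have "(h \<cdot>\<^sub>m 1\<^sub>m p) *\<^sub>v v = h \<cdot>\<^sub>v v"
    using v by (intro eq_vecI) (auto simp: row_smult)
  then show ?thesis
    using X v by (simp add: add_mult_distrib_mat_vec[of _ p p])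
qed

lemma ridge_matrix_scalar_prod:
  fixes X :: "real mat"
  assumes X: "X \<in> carrier_mat n p" and v: "v \<in> carrier_vec p" and z: "z \<in> carrier_vec p"
  shows "((X\<^sup>T * X + h \<cdot>\<^sub>m 1\<^sub>m p) *\<^sub>v v) \<bullet> z = (X *\<^sub>v v) \<bullet> (X *\<^sub>v z) + h * (v \<bullet> z)"
proof -
  have "(X\<^sup>T * X) *\<^sub>v v \<in> carrier_vec p" using X v by simp
  then show ?thesis
    unfolding ridge_matrix_mult_vec[OF X v] using v z gram_scalar_prod[OF X v z]
    by (simp add: add_scalar_prod_distrib[of _ p])
qed

text \<open>Positive definiteness: a kernel vector \<open>v\<close> satisfies
  \<open>(X v) \<bullet> (X v) + h (v \<bullet> v) = 0\<close>, which forces \<open>v = 0\<close>.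
  This gives the \<open>the\<close> in \<open>ridge_estimator\<close> a meaningful argument.\<close>

lemma ridge_matrix_invertible:
  fixes X :: "real mat"
  assumes X: "X \<in> carrier_mat n p" and h: "h > 0"
  obtains B where "mat_inverse (X\<^sup>T * X + h \<cdot>\<^sub>m 1\<^sub>m p) = Some B" "B \<in> carrier_mat p p"
    "(X\<^sup>T * X + h \<cdot>\<^sub>m 1\<^sub>m p) * B = 1\<^sub>m p" "B * (X\<^sup>T * X + h \<cdot>\<^sub>m 1\<^sub>m p) = 1\<^sub>m p"
proof -
  define A where "A = X\<^sup>T * X + h \<cdot>\<^sub>m 1\<^sub>m p"
  have A: "A \<in> carrier_mat p p" unfolding A_def using X by simp
  have "v = 0\<^sub>v p" if v: "v \<in> carrier_vec p" "A *\<^sub>v v = 0\<^sub>v p" for v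
  proof -
    have "(X *\<^sub>v v) \<bullet> (X *\<^sub>v v) + h * (v \<bullet> v) = 0"
      using ridge_matrix_scalar_prod[OF X v(1) v(1), of h] v unfolding A_def by simp
    then have "h * (v \<bullet> v) \<le> 0"
      using scalar_prod_self_nonneg[of "X *\<^sub>v v"] by linarith
    then have "v \<bullet> v = 0"
      using h scalar_prod_self_nonneg[of v] by (simp add: mult_le_0_iff)
    then show ?thesis using scalar_prod_self_eq_0[OF v(1)] by simp
  qed
  then have "det A \<noteq> 0" unfolding det_0_iff_vec_prod_zero_field[OF A] by auto
  from det_non_zero_imp_unit[OF A this, of "()"] obtain B where "mat_inverse A = Some B"
    using mat_inverse(1)[OF A, of "()"] by (cases "mat_inverse A") auto
  with mat_inverse(2)[OF A this] show thesis
    unfolding A_def by (intro that) auto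
qed

text \<open>With \<open>A\<close> the ridge matrix and \<open>w\<close> the row, \<open>A w\<close>
  is the unit vector at \<open>j\<close>. Pairing with \<open>w\<close> gives
  \<open>(X w) \<bullet> (X w) + h (w \<bullet> w) = w $ j\<close>, and the second term on the left
  absorbs \<open>w $ j\<close> up to \<open>1 / h\<close>.\<close>

lemma ridge_noise_coefficients_bound:
  fixes X B :: "real mat"
  assumes X: "X \<in> carrier_mat n p" and h: "h > 0"
    and B: "B \<in> carrier_mat p p" and BA: "B * (X\<^sup>T * X + h \<cdot>\<^sub>m 1\<^sub>m p) = 1\<^sub>m p" and j: "j < p"
  shows "(X *\<^sub>v row B j) \<bullet> (X *\<^sub>v row B j) \<le> 1 / h"
proof -
  define A where "A = X\<^sup>T * X + h \<cdot>\<^sub>m 1\<^sub>m p"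
  define w where "w = row B j"
  have A: "A \<in> carrier_mat p p" unfolding A_def using X by simp
  have w: "w \<in> carrier_vec p" unfolding w_def using B j by auto
  have "(X\<^sup>T * X)\<^sup>T = X\<^sup>T * X"
    using X by (simp add: transpose_mult[of _ p n _ p])
  moreover have "(h \<cdot>\<^sub>m 1\<^sub>m p)\<^sup>T = h \<cdot>\<^sub>m 1\<^sub>m p"
    by (intro eq_matI) auto
  ultimately have sym: "A\<^sup>T = A"
    unfolding A_def using X by (simp add: transpose_add[of _ p p])
  \<comment> \<open>Symmetry of \<open>A\<close> turns the rows of its left inverse into solutions
    of linear systems with matrix \<open>A\<close>.\<close>
  have "A * B\<^sup>T = 1\<^sub>m p"
    using transpose_mult[OF B A] BA sym unfolding A_def[symmetric] by simp
  then have "A *\<^sub>v w = unit_vec p j"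
    using col_mult2[OF A, of "B\<^sup>T" p j] B j unfolding w_def by simp
  then have "(X *\<^sub>v w) \<bullet> (X *\<^sub>v w) + h * (w \<bullet> w) = w $ j"
    using ridge_matrix_scalar_prod[OF X w w, of h] w j unfolding A_def by simp
  moreover have "(w $ j)\<^sup>2 \<le> w \<bullet> w"
    using component_squared_le_scalar_prod_self w j by simp
  then have "h * (w $ j)\<^sup>2 \<le> h * (w \<bullet> w)" using h by simp
  \<comment> \<open>This is \<open>x \<le> x\<^sup>2 + 1\<close> for \<open>x = h * w $ j\<close>,
    divided by \<open>h\<close>.\<close>
  moreover have "w $ j \<le> h * (w $ j)\<^sup>2 + 1 / h"
  proof -
    have "h * (w $ j) \<le> (h * w $ j)\<^sup>2 + 1"
      using sum_squares_ge_zero[of "h * w $ j - 1 / 2" 0] by (simp add: power2_eq_square algebra_simps)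
    then show ?thesis using h by (simp add: field_simps power2_eq_square)
  qed
  ultimately show ?thesis unfolding w_def by linarith
qed

lemma ridge_bias_bound:
  fixes X B :: "real mat"
  assumes X: "X \<in> carrier_mat n p" and h: "h > 0"
    and B: "B \<in> carrier_mat p p" and AB: "(X\<^sup>T * X + h \<cdot>\<^sub>m 1\<^sub>m p) * B = 1\<^sub>m p"
    and z: "z \<in> carrier_vec n" and \<theta>: "\<theta> = X\<^sup>T *\<^sub>v z" and j: "j < p"
  shows "\<bar>(B *\<^sub>v \<theta>) $ j\<bar> \<le> inverse (min_pos_eigenvalue (X\<^sup>T * X)) * euclidean_norm \<theta>"
proof -
  define A where "A = X\<^sup>T * X + h \<cdot>\<^sub>m 1\<^sub>m p"
  define b where "b = B *\<^sub>v \<theta>"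
  define \<mu> where "\<mu> = min_pos_eigenvalue (X\<^sup>T * X)"
  have A: "A \<in> carrier_mat p p" unfolding A_def using X by simp
  have \<theta>c: "\<theta> \<in> carrier_vec p" unfolding \<theta> using X z by simp
  have b: "b \<in> carrier_vec p" unfolding b_def using B \<theta>c by simp
  have Ab: "A *\<^sub>v b = \<theta>"
    unfolding b_def using assoc_mult_mat_vec[OF A B \<theta>c] AB \<theta>c unfolding A_def by simp
  \<comment> \<open>Pairing \<open>A b = \<theta>\<close> with a kernel vector \<open>v\<close>
    leaves \<open>h (b \<bullet> v) = \<theta> \<bullet> v\<close>, and the right side vanishes
    because \<open>\<theta>\<close> lies in the row space.\<close>
  have "b \<bullet> v = 0" if v: "v \<in> carrier_vec p" "X *\<^sub>v v = 0\<^sub>v n" for v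
  proof -
    have "\<theta> \<bullet> v = 0"
      unfolding \<theta> using transpose_vec_mult_scalar[OF X v(1) z] v(2) z by simp
    then have "h * (b \<bullet> v) = 0"
      using ridge_matrix_scalar_prod[OF X b v(1), of h] Ab v X b unfolding A_def by simp
    then show ?thesis using h by simp
  qed
  then have b_ker: "v \<bullet> b = 0" if "v \<in> carrier_vec p" "X *\<^sub>v v = 0\<^sub>v n" for v
    using that comm_scalar_prod[OF that(1) b] by simp
  have norm_nonneg: "euclidean_norm v \<ge> 0" for v
    unfolding euclidean_norm_def by (simp add: scalar_prod_self_nonneg)
  show ?thesis
  \<comment> \<open>The eigenvalue bound applies to nonzero vectors only; for \<open>b = 0\<close>
    also \<open>\<theta> = 0\<close>, and both sides vanish.\<close>
  proof (cases "b = 0\<^sub>v p")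
    case True
    moreover have "A *\<^sub>v 0\<^sub>v p = 0\<^sub>v p" using A by (intro eq_vecI) auto
    ultimately have "\<theta> = 0\<^sub>v p" using Ab by simp
    then show ?thesis using True j unfolding b_def[symmetric] by (simp add: euclidean_norm_def)
  next
    case False
    have \<mu>: "\<mu> > 0" and rayleigh: "\<mu> * (b \<bullet> b) \<le> (X *\<^sub>v b) \<bullet> (X *\<^sub>v b)"
      unfolding \<mu>_def using min_pos_eigenvalue_gram[OF X b False b_ker] by auto
    have "b \<bullet> b \<noteq> 0" using scalar_prod_self_eq_0[OF b] False by simp
    then have norm_pos: "euclidean_norm b > 0"
      unfolding euclidean_norm_def using scalar_prod_self_nonneg[of b] by simp
    have "euclidean_norm b * (\<mu> * euclidean_norm b) = \<mu> * (b \<bullet> b)"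
      unfolding euclidean_norm_def using scalar_prod_self_nonneg[of b] by simp
    also have "\<dots> \<le> (X *\<^sub>v b) \<bullet> (X *\<^sub>v b) + h * (b \<bullet> b)"
      using rayleigh h scalar_prod_self_nonneg[of b] by (simp add: add_increasing2)
    also have "\<dots> = \<theta> \<bullet> b"
      using ridge_matrix_scalar_prod[OF X b b, of h] Ab unfolding A_def by simp
    also have "\<dots> \<le> euclidean_norm b * euclidean_norm \<theta>"
      using scalar_prod_le_euclidean_norm[of \<theta> b] b \<theta>c by (simp add: mult.commute)
    finally have "\<mu> * euclidean_norm b \<le> euclidean_norm \<theta>"
      using norm_pos by simp
    then have "euclidean_norm b \<le> inverse \<mu> * euclidean_norm \<theta>"
      using \<mu> by (simp add: field_simps)
    moreover have "\<bar>b $ j\<bar> \<le> euclidean_norm b"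
      unfolding euclidean_norm_def
      using component_squared_le_scalar_prod_self[of j b] b j by (simp add: real_le_rsqrt)
    ultimately show ?thesis unfolding b_def \<mu>_def by linarith
  qed
qed

text \<open>The coefficients \<open>b\<close> and \<open>c\<close> are fixed before the error vector
  \<open>e\<close>, so all randomness enters through a linear combination of the errors with
  deterministic weights.\<close>

lemma ridge_estimator_decomposition:
  fixes X :: "real mat"
  assumes X: "X \<in> carrier_mat n p" and h: "h > 0" and \<beta>: "\<beta> \<in> carrier_vec p"
    and proj: "is_orthogonal_projection (row_space_of X) \<beta> \<theta>"
  obtains b :: "nat \<Rightarrow> real" and c :: "nat \<Rightarrow> nat \<Rightarrow> real" where
    "\<And>e. dim_vec (ridge_estimator X h (X *\<^sub>v \<beta> + vec n e)) = p"
    "\<And>e j. j < p \<Longrightarrow> ridge_estimator X h (X *\<^sub>v \<beta> + vec n e) $ j = \<theta> $ j - h * b j + (\<Sum>i<n. c j i * e i)"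
    "\<And>j. j < p \<Longrightarrow> \<bar>b j\<bar> \<le> inverse (min_pos_eigenvalue (X\<^sup>T * X)) * euclidean_norm \<theta>"
    "\<And>j. j < p \<Longrightarrow> (\<Sum>i<n. (c j i)\<^sup>2) \<le> 1 / h"
    "\<theta> \<in> carrier_vec p"
proof -
  define A where "A = X\<^sup>T * X + h \<cdot>\<^sub>m 1\<^sub>m p"
  have A: "A \<in> carrier_mat p p" unfolding A_def using X by simp
  obtain B where inv: "mat_inverse A = Some B" and B: "B \<in> carrier_mat p p"
    and AB: "A * B = 1\<^sub>m p" and BA: "B * A = 1\<^sub>m p"
    using ridge_matrix_invertible[OF X h] unfolding A_def by blast
  have row_space: "row_space_of X = {w \<in> carrier_vec p. \<exists>z \<in> carrier_vec n. X\<^sup>T *\<^sub>v z = w}"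
    unfolding row_space_of_def using vec_space.row_space_eq[of X n p] X by auto
  obtain z where z: "z \<in> carrier_vec n" and \<theta>: "\<theta> = X\<^sup>T *\<^sub>v z"
    using proj unfolding is_orthogonal_projection_def row_space by auto
  have \<theta>c: "\<theta> \<in> carrier_vec p" unfolding \<theta> using X z by simp
  have diff: "\<beta> - \<theta> \<in> carrier_vec p" using \<beta> \<theta>c by simp
  \<comment> \<open>The residual \<open>\<beta> - \<theta>\<close> is orthogonal to the row space;
    testing it against the element \<open>X\<^sup>T X (\<beta> - \<theta>)\<close> shows that
    \<open>X\<close> annihilates it.\<close>
  have "(X *\<^sub>v (\<beta> - \<theta>)) \<bullet> (X *\<^sub>v (\<beta> - \<theta>)) = 0"
  proof -
    have "X\<^sup>T *\<^sub>v (X *\<^sub>v (\<beta> - \<theta>)) \<in> row_space_of X"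
      unfolding row_space using X diff by auto
    then have "(\<beta> - \<theta>) \<bullet> (X\<^sup>T *\<^sub>v (X *\<^sub>v (\<beta> - \<theta>))) = 0"
      using proj unfolding is_orthogonal_projection_def by blast
    then show ?thesis
      using transpose_vec_mult_scalar[OF X diff, of "X *\<^sub>v (\<beta> - \<theta>)"] X diff
        comm_scalar_prod[OF diff, of "X\<^sup>T *\<^sub>v (X *\<^sub>v (\<beta> - \<theta>))"] by simp
  qed
  then have "X *\<^sub>v (\<beta> - \<theta>) = 0\<^sub>v n"
    using scalar_prod_self_eq_0[of "X *\<^sub>v (\<beta> - \<theta>)" n] X diff by simp
  then have zero: "(X *\<^sub>v \<beta> - X *\<^sub>v \<theta>) $ i = 0" if "i < n" for i
    using that mult_minus_distrib_mat_vec[OF X \<beta> \<theta>c] by simp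
  have X\<beta>: "X *\<^sub>v \<beta> = X *\<^sub>v \<theta>"
    using zero X by (intro eq_vecI) auto
  have est: "ridge_estimator X h y = B *\<^sub>v (X\<^sup>T *\<^sub>v y)" for y
    unfolding ridge_estimator_def using inv X unfolding A_def by simp
  show thesis
  proof (rule that[of "\<lambda>j. (B *\<^sub>v \<theta>) $ j" "\<lambda>j i. (X *\<^sub>v row B j) $ i"])
    show "\<theta> \<in> carrier_vec p" by (rule \<theta>c)
    show "dim_vec (ridge_estimator X h (X *\<^sub>v \<beta> + vec n e)) = p" for e
      unfolding est using B by simp
    fix j assume j: "j < p"
    show "\<bar>(B *\<^sub>v \<theta>) $ j\<bar> \<le> inverse (min_pos_eigenvalue (X\<^sup>T * X)) * euclidean_norm \<theta>"
      using ridge_bias_bound[OF X h B _ z \<theta> j] AB unfolding A_def by simp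
    show "(\<Sum>i<n. ((X *\<^sub>v row B j) $ i)\<^sup>2) \<le> 1 / h"
      using ridge_noise_coefficients_bound[OF X h B _ j] BA X unfolding A_def
      by (simp add: scalar_prod_def power2_eq_square atLeast0LessThan)
    fix e :: "nat \<Rightarrow> real"
    have rowB: "row B j \<in> carrier_vec p" using B j by auto
    have v: "vec n e \<in> carrier_vec n" by simp
    have XXt: "(X\<^sup>T * X) *\<^sub>v \<theta> \<in> carrier_vec p" and Xe: "X\<^sup>T *\<^sub>v vec n e \<in> carrier_vec p"
      and h\<theta>: "h \<cdot>\<^sub>v \<theta> \<in> carrier_vec p"
      using X \<theta>c by auto
    have "X\<^sup>T *\<^sub>v (X *\<^sub>v \<beta> + vec n e) = (X\<^sup>T * X) *\<^sub>v \<theta> + X\<^sup>T *\<^sub>v vec n e"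
      unfolding X\<beta> using X \<theta>c by (simp add: mult_add_distrib_mat_vec[of _ p n] assoc_mult_mat_vec[of _ p n _ p])
    \<comment> \<open>Writing the Gram matrix as \<open>A\<close> minus \<open>h\<close> times the
      identity isolates the shrinkage bias once \<open>B\<close> is applied.\<close>
    also have "\<dots> = (A *\<^sub>v \<theta> - h \<cdot>\<^sub>v \<theta>) + X\<^sup>T *\<^sub>v vec n e"
    proof -
      have "(v + w) - w = v" if "v \<in> carrier_vec p" "w \<in> carrier_vec p" for v w :: "real vec"
        using that by (intro eq_vecI) auto
      from this[OF XXt h\<theta>] show ?thesis
        unfolding A_def ridge_matrix_mult_vec[OF X \<theta>c] by simp
    qed
    finally have "row B j \<bullet> (X\<^sup>T *\<^sub>v (X *\<^sub>v \<beta> + vec n e)) =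
        row B j \<bullet> (A *\<^sub>v \<theta>) - h * (row B j \<bullet> \<theta>) + row B j \<bullet> (X\<^sup>T *\<^sub>v vec n e)"
      using A \<theta>c rowB Xe h\<theta>
      by (simp add: scalar_prod_add_distrib[of _ p] scalar_prod_minus_distrib[of _ p])
    moreover have "row B j \<bullet> (A *\<^sub>v \<theta>) = \<theta> $ j"
    proof -
      have "B *\<^sub>v (A *\<^sub>v \<theta>) = \<theta>" using assoc_mult_mat_vec[OF B A \<theta>c] BA \<theta>c by simp
      then show ?thesis using B j by (metis carrier_matD(1) index_mult_mat_vec)
    qed
    moreover have "row B j \<bullet> (X\<^sup>T *\<^sub>v vec n e) = (\<Sum>i<n. (X *\<^sub>v row B j) $ i * e i)"
      using transpose_vec_mult_scalar[OF X rowB v] comm_scalar_prod[OF rowB Xe]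
        comm_scalar_prod[OF v, of "X *\<^sub>v row B j"] X rowB
      by (simp add: scalar_prod_def atLeast0LessThan)
    ultimately show "ridge_estimator X h (X *\<^sub>v \<beta> + vec n e) $ j =
        \<theta> $ j - h * (B *\<^sub>v \<theta>) $ j + (\<Sum>i<n. (X *\<^sub>v row B j) $ i * e i)"
      unfolding est using B j by simp
  qed
qed

section \<open>Failure probability of the inclusions for a fixed sample size\<close>

text \<open>If no noise component reaches half of the allowed deviation, both inclusions hold
  deterministically; the union bound over components controls the remaining event. \<open>L\<close>
  stands for the iterated logarithm.\<close>

lemma ridge_threshold_error_bound:
  fixes M :: "'a measure" and \<epsilon> :: "nat \<Rightarrow> 'a \<Rightarrow> real"
  assumes prob: "prob_space M" and \<sigma>: "\<sigma> > 0"
    and normal: "\<And>i. i < n \<Longrightarrow> distributed M lborel (\<epsilon> i) (normal_density 0 \<sigma>)"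
    and indep: "prob_space.indep_vars M (\<lambda>_. borel) \<epsilon> {..<n}"
    and X: "X \<in> carrier_mat n p" and \<beta>: "\<beta> \<in> carrier_vec p"
    and proj: "is_orthogonal_projection (row_space_of X) \<beta> \<theta>"
    and h: "h > 0" and a: "a > 0" and L: "L > 0"
    and bias: "h * (inverse (min_pos_eigenvalue (X\<^sup>T * X)) * euclidean_norm \<theta>) \<le> a / (2 * (L + 1))"
  defines "\<theta>hat \<equiv> \<lambda>\<omega>. ridge_estimator X h (X *\<^sub>v \<beta> + vec n (\<lambda>i. \<epsilon> i \<omega>))"
  shows "\<bar>1 - measure M {\<omega> \<in> space M.
      large_components \<theta> (a * (1 + inverse L)) \<subseteq> large_components (\<theta>hat \<omega>) a \<and>
      large_components (\<theta>hat \<omega>) a \<subseteq> large_components \<theta> (a / (1 + inverse L))}\<bar>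
    \<le> 2 * real p * exp (- (a / (2 * (L + 1)))\<^sup>2 * h / (2 * \<sigma>\<^sup>2))"
proof -
  interpret prob_space M by (rule prob)
  define d where "d = a / (2 * (L + 1))"
  have d: "d > 0" unfolding d_def using a L by simp
  obtain b c where dim: "\<And>e. dim_vec (ridge_estimator X h (X *\<^sub>v \<beta> + vec n e)) = p"
    and comp: "\<And>e j. j < p \<Longrightarrow> ridge_estimator X h (X *\<^sub>v \<beta> + vec n e) $ j = \<theta> $ j - h * b j + (\<Sum>i<n. c j i * e i)"
    and b: "\<And>j. j < p \<Longrightarrow> \<bar>b j\<bar> \<le> inverse (min_pos_eigenvalue (X\<^sup>T * X)) * euclidean_norm \<theta>"
    and c: "\<And>j. j < p \<Longrightarrow> (\<Sum>i<n. (c j i)\<^sup>2) \<le> 1 / h"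
    and \<theta>c: "\<theta> \<in> carrier_vec p"
    by (rule ridge_estimator_decomposition[OF X h \<beta> proj]) blast
  have rv [measurable]: "\<epsilon> i \<in> borel_measurable M" if "i \<in> {..<n}" for i
    using distributed_measurable[OF normal] that by simp
  define Z where "Z j \<omega> = (\<Sum>i<n. c j i * \<epsilon> i \<omega>)" for j \<omega>
  have Z [measurable]: "Z j \<in> borel_measurable M" for j
    unfolding Z_def by measurable
  have hat: "\<theta>hat \<omega> $ j = \<theta> $ j - h * b j + Z j \<omega>" if "j < p" for j \<omega>
    unfolding \<theta>hat_def Z_def comp[OF that] ..
  have dims: "dim_vec (\<theta>hat \<omega>) = p" "dim_vec \<theta> = p" for \<omega>
    unfolding \<theta>hat_def using dim \<theta>c by auto
  define S where "S = {\<omega> \<in> space M.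
      large_components \<theta> (a * (1 + inverse L)) \<subseteq> large_components (\<theta>hat \<omega>) a \<and>
      large_components (\<theta>hat \<omega>) a \<subseteq> large_components \<theta> (a / (1 + inverse L))}"
  \<comment> \<open>Finitely many conditions on the measurable \<open>Z j\<close> exhibit
    \<open>S\<close> as an event.\<close>
  have S_eq: "S = {\<omega> \<in> space M. \<forall>j\<in>{..<p}.
      (\<bar>\<theta> $ j\<bar> > a * (1 + inverse L) \<longrightarrow> \<bar>\<theta> $ j - h * b j + Z j \<omega>\<bar> > a) \<and>
      (\<bar>\<theta> $ j - h * b j + Z j \<omega>\<bar> > a \<longrightarrow> \<bar>\<theta> $ j\<bar> > a / (1 + inverse L))}"
  proof -
    have subset: "large_components v s \<subseteq> large_components w r \<longleftrightarrow>
        (\<forall>j\<in>{..<p}. \<bar>v $ j\<bar> > s \<longrightarrow> \<bar>w $ j\<bar> > r)"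
      if "dim_vec v = p" "dim_vec w = p" for v w s r
      using that unfolding large_components_def by auto
    have hat': "j \<in> {..<p} \<Longrightarrow> \<theta>hat \<omega> $ j = \<theta> $ j - h * b j + Z j \<omega>" for j \<omega>
      using hat by simp
    show ?thesis
      unfolding S_def subset[OF dims(2) dims(1)] subset[OF dims(1) dims(2)] ball_conj_distrib
      by (intro Collect_cong conj_cong refl ball_cong) (simp_all only: hat')
  qed
  have S_meas: "S \<in> events" unfolding S_eq by measurable
  define F where "F j = {\<omega> \<in> space M. \<bar>Z j \<omega>\<bar> \<ge> d}" for j
  have F_meas: "F j \<in> events" for j unfolding F_def by measurable
  \<comment> \<open>The lower gap \<open>a - a / u\<close> equals \<open>a / (L + 1)\<close>, the
    upper gap \<open>a * u - a\<close> equals \<open>a / L\<close>; the smaller one fixes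
    \<open>d\<close>.\<close>
  have two_d: "2 * d = a - a / (1 + inverse L)" and two_d': "2 * d \<le> a * (1 + inverse L) - a"
    unfolding d_def using a L by (simp_all add: field_simps)
  have "\<omega> \<in> S" if \<omega>: "\<omega> \<in> space M" "\<And>j. j < p \<Longrightarrow> \<omega> \<notin> F j" for \<omega>
  proof -
    have "\<bar>\<theta> $ j - h * b j + Z j \<omega> - \<theta> $ j\<bar> < 2 * d" if j: "j < p" for j
    proof -
      have "\<bar>h * b j\<bar> = h * \<bar>b j\<bar>" using h by (simp add: abs_mult)
      also have "\<dots> \<le> d"
        using mult_left_mono[OF b[OF j], of h] h bias unfolding d_def by linarith
      finally have "\<bar>h * b j\<bar> \<le> d" .
      moreover have "\<bar>Z j \<omega>\<bar> < d" using \<omega>(1) \<omega>(2)[OF j] unfolding F_def by simp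
      ultimately show ?thesis by linarith
    qed
    then show ?thesis unfolding S_eq using \<omega>(1) two_d two_d' by fastforce
  qed
  then have sub: "space M - S \<subseteq> (\<Union>j<p. F j)" by auto
  have "1 - prob S = prob (space M - S)"
    using prob_compl[OF S_meas] by simp
  also have "\<dots> \<le> prob (\<Union>j<p. F j)"
    using sub F_meas by (intro finite_measure_mono) auto
  also have "\<dots> \<le> (\<Sum>j<p. prob (F j))"
    using F_meas by (intro measure_UNION_le) auto
  also have "\<dots> \<le> (\<Sum>j<p. 2 * exp (- d\<^sup>2 / (2 * \<sigma>\<^sup>2 * (1 / h))))"
    unfolding F_def Z_def
    by (intro sum_mono normal_combination_tail[OF \<sigma> normal indep]) (use h c d in auto)
  also have "\<dots> = 2 * real p * exp (- d\<^sup>2 * h / (2 * \<sigma>\<^sup>2))"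
    by simp
  finally have "1 - prob S \<le> 2 * real p * exp (- d\<^sup>2 * h / (2 * \<sigma>\<^sup>2))" .
  then show ?thesis unfolding S_def[symmetric] d_def[symmetric] using prob_le_1[of S] by simp
qed

section \<open>Asymptotics: the growth conditions make the bound of order
  \<open>(max n p) powr (- t)\<close>\<close>

theorem theorem2:
  fixes M :: "nat \<Rightarrow> 'a measure"
    and \<epsilon> :: "nat \<Rightarrow> nat \<Rightarrow> 'a \<Rightarrow> real"
    and \<sigma> :: real
    and p :: "nat \<Rightarrow> nat"
    and X :: "nat \<Rightarrow> real mat"
    and \<beta> \<theta> :: "nat \<Rightarrow> real vec"
    and y \<theta>hat :: "nat \<Rightarrow> 'a \<Rightarrow> real vec"
    and \<eta> \<tau> \<nu> \<alpha> C1 C2 t :: real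
    and a u h :: "nat \<Rightarrow> real"
  assumes prob: "\<And>n. n \<ge> 1 \<Longrightarrow> prob_space (M n)"
    and sigma: "\<sigma> > 0"
    and normal: "\<And>n i. n \<ge> 1 \<Longrightarrow> i < n \<Longrightarrow>
                   distributed (M n) lborel (\<epsilon> n i) (normal_density 0 \<sigma>)"
    and indep: "\<And>n. n \<ge> 1 \<Longrightarrow>
                   prob_space.indep_vars (M n) (\<lambda>_. borel) (\<epsilon> n) {..<n}"
    and X: "\<And>n. n \<ge> 1 \<Longrightarrow> X n \<in> carrier_mat n (p n)"
    and X_nonzero: "\<And>n. n \<ge> 1 \<Longrightarrow> X n \<noteq> 0\<^sub>m n (p n)"
    and beta: "\<And>n. n \<ge> 1 \<Longrightarrow> \<beta> n \<in> carrier_vec (p n)"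
    and y: "\<And>n \<omega>. y n \<omega> = X n *\<^sub>v \<beta> n + vec n (\<lambda>i. \<epsilon> n i \<omega>)"
    and theta: "\<And>n. n \<ge> 1 \<Longrightarrow>
                   is_orthogonal_projection (row_space_of (X n)) (\<beta> n) (\<theta> n)"
    and theta_hat: "\<And>n \<omega>. \<theta>hat n \<omega> = ridge_estimator (X n) (h n) (y n \<omega>)"
    and eta: "\<eta> \<le> 1"
    and lambda_growth: "(\<lambda>n. inverse (min_pos_eigenvalue ((X n)\<^sup>T * X n)))
                          \<in> O(\<lambda>n. real n powr (- \<eta>))"
    and tau: "\<tau> < \<eta>"
    and theta_growth: "(\<lambda>n. euclidean_norm (\<theta> n)) \<in> O(\<lambda>n. real n powr \<tau>)"
    and nu: "0 < \<nu>" "\<nu> < 1"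
    and p_growth: "(\<lambda>n. real (p n)) \<in> O(\<lambda>n. exp (real n powr \<nu>))"
    and C1: "C1 > 0"
    and alpha: "0 < \<alpha>" "\<alpha> \<le> 1 / 2" "\<alpha> < (\<eta> - \<nu> - \<tau>) / 3"
    and a: "\<And>n. a n = C1 * real n powr (- \<alpha>)"
    and u: "\<And>n. u n = 1 + inverse (ln (ln (real n)))"
    and C2: "C2 > 0"
    and h: "\<And>n. h n = C2 * inverse ((a n)\<^sup>2) * (ln (ln (real n))) ^ 3
                       * ln (real (max n (p n)))"
    and t: "t > 0"
  shows "(\<lambda>n. 1 - measure (M n)
            {\<omega> \<in> space (M n).
               large_components (\<theta> n) (a n * u n) \<subseteq> large_components (\<theta>hat n \<omega>) (a n) \<and>
               large_components (\<theta>hat n \<omega>) (a n) \<subseteq> large_components (\<theta> n) (a n / u n)})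
         \<in> O(\<lambda>n. real (max n (p n)) powr (- t))"
proof -
  define L where "L n = ln (ln (real n))" for n :: nat
  define N where "N n = real (max n (p n))" for n
  \<comment> \<open>The slack in the condition on \<open>\<alpha>\<close>: the power of
    \<open>n\<close> left over to beat iterated logarithms and constants in the bias.\<close>
  define \<kappa> where "\<kappa> = \<eta> - \<nu> - \<tau> - 3 * \<alpha>"
  have \<kappa>: "\<kappa> > 0" using alpha(3) unfolding \<kappa>_def by simp
  \<comment> \<open>The bound 1 gives \<open>L + 1 \<le> 2 * L\<close>; the other constant is what
    the noise exponent requires to reach \<open>t + 1\<close>.\<close>
  have L_large: "eventually (\<lambda>n. L n \<ge> max 1 (32 * \<sigma>\<^sup>2 * (t + 1) / C2)) sequentially"
  proof -
    have "filterlim L at_top sequentially" unfolding L_def by real_asymp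
    then show ?thesis unfolding filterlim_at_top by blast
  qed
  obtain K where K: "K > 0" "eventually (\<lambda>n. real (p n) \<le> K * exp (real n powr \<nu>)) sequentially"
    using landau_o.bigE[OF p_growth] by auto
  obtain K1 where K1: "K1 > 0"
      "eventually (\<lambda>n. \<bar>inverse (min_pos_eigenvalue ((X n)\<^sup>T * X n))\<bar> \<le> K1 * real n powr (- \<eta>)) sequentially"
    using landau_o.bigE[OF lambda_growth] by auto
  obtain K2 where K2: "K2 > 0"
      "eventually (\<lambda>n. \<bar>euclidean_norm (\<theta> n)\<bar> \<le> K2 * real n powr \<tau>) sequentially"
    using landau_o.bigE[OF theta_growth] by auto
  \<comment> \<open>The factor 2 absorbs the constant \<open>K\<close>; \<open>n\<close> itself is
    also below the exponential since \<open>\<nu> > 0\<close>.\<close>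
  have "eventually (\<lambda>n. ln (N n) \<le> 2 * real n powr \<nu>) sequentially"
  proof -
    have "eventually (\<lambda>n. real n \<le> exp (2 * real n powr \<nu>)) sequentially"
      using nu(1) by real_asymp
    moreover have "eventually (\<lambda>n. K * exp (real n powr \<nu>) \<le> exp (2 * real n powr \<nu>)) sequentially"
      using nu(1) K(1) by real_asymp
    ultimately show ?thesis
      using K(2) eventually_ge_at_top[of 1]
    proof eventually_elim
      case (elim n)
      then have "0 < N n" "N n \<le> exp (2 * real n powr \<nu>)" unfolding N_def by auto
      then show ?case by (metis ln_exp ln_mono)
    qed
  qed
  \<comment> \<open>After clearing denominators the bias condition has this form with 4 in place of
    8.\<close>
  moreover have "eventually (\<lambda>n. 8 * (C2 * K1 * K2 / C1 ^ 3) * L n ^ 3 * (L n + 1) \<le> real n powr \<kappa>) sequentially"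
    unfolding L_def using \<kappa> by real_asymp
  ultimately have "eventually (\<lambda>n. \<bar>1 - measure (M n)
            {\<omega> \<in> space (M n).
               large_components (\<theta> n) (a n * u n) \<subseteq> large_components (\<theta>hat n \<omega>) (a n) \<and>
               large_components (\<theta>hat n \<omega>) (a n) \<subseteq> large_components (\<theta> n) (a n / u n)}\<bar>
         \<le> 2 * N n powr (- t)) sequentially"
    using L_large K1(2) K2(2) eventually_gt_at_top[of 1]
  proof eventually_elim
    case (elim n)
    then have n: "n \<ge> 1" "real n > 1" and L: "L n \<ge> 1" "32 * \<sigma>\<^sup>2 * (t + 1) / C2 \<le> L n" by auto
    have N: "N n > 1" "real (p n) \<le> N n" using n unfolding N_def by auto
    have an: "a n > 0" unfolding a using C1 n by simp
    have hn: "h n = C2 * L n ^ 3 * ln (N n) / (a n)\<^sup>2"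
      unfolding h L_def N_def by (simp add: divide_inverse mult_ac)
    have h_pos: "h n > 0" unfolding hn using C2 L N an by simp
    have "h n * (inverse (min_pos_eigenvalue ((X n)\<^sup>T * X n)) * euclidean_norm (\<theta> n))
        \<le> h n * ((K1 * real n powr (- \<eta>)) * (K2 * real n powr \<tau>))"
    proof (rule mult_left_mono)
      have "inverse (min_pos_eigenvalue ((X n)\<^sup>T * X n)) * euclidean_norm (\<theta> n)
          \<le> \<bar>inverse (min_pos_eigenvalue ((X n)\<^sup>T * X n))\<bar> * \<bar>euclidean_norm (\<theta> n)\<bar>"
        by (metis abs_ge_self abs_mult)
      also have "\<dots> \<le> (K1 * real n powr (- \<eta>)) * (K2 * real n powr \<tau>)"
        using elim K1(1) K2(1) by (intro mult_mono) auto
      finally show "inverse (min_pos_eigenvalue ((X n)\<^sup>T * X n)) * euclidean_norm (\<theta> n)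
          \<le> (K1 * real n powr (- \<eta>)) * (K2 * real n powr \<tau>)" .
    qed (use h_pos in simp)
    also have "\<dots> \<le> (C2 * L n ^ 3 * (2 * real n powr \<nu>) / (a n)\<^sup>2) *
        ((K1 * real n powr (- \<eta>)) * (K2 * real n powr \<tau>))"
      unfolding hn using elim C2 L an K1(1) K2(1)
      by (intro mult_right_mono divide_right_mono mult_left_mono) auto
    also have "\<dots> \<le> a n / (2 * (L n + 1))"
    proof -
      \<comment> \<open>\<open>T\<close> collects the powers of \<open>n\<close> in the bias;
        \<open>a\<^sup>3\<close> exceeds it by the factor \<open>n powr \<kappa>\<close>, up to a
        constant.\<close>
      define T where "T = real n powr \<nu> * real n powr (- \<eta>) * real n powr \<tau>"
      have T: "T * real n powr \<kappa> = real n powr (- 3 * \<alpha>)"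
        unfolding T_def \<kappa>_def using n by (simp add: powr_add[symmetric])
      have T_pos: "T > 0" unfolding T_def using n by simp
      have cube: "(a n) ^ 3 = C1 ^ 3 * (T * real n powr \<kappa>)"
      proof -
        have "(real n powr (- \<alpha>)) ^ 3 = real n powr (- 3 * \<alpha>)"
          using n by (simp add: powr_realpow[symmetric] powr_powr mult.commute)
        then show ?thesis unfolding T a by (simp add: power_mult_distrib)
      qed
      have "8 * (C2 * K1 * K2) * L n ^ 3 * (L n + 1) \<le> C1 ^ 3 * real n powr \<kappa>"
        using elim(2) C1 by (simp add: field_simps)
      then have "8 * (C2 * K1 * K2) * L n ^ 3 * (L n + 1) * T \<le> (a n) ^ 3"
        unfolding cube using mult_right_mono[OF _ less_imp_le[OF T_pos]] by (metis mult.assoc mult.commute)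
      moreover have "0 \<le> (C2 * K1 * K2) * L n ^ 3 * (L n + 1) * T"
        using C2 K1(1) K2(1) L T_pos by simp
      ultimately have "4 * (C2 * K1 * K2) * L n ^ 3 * (L n + 1) * T \<le> (a n) ^ 3"
        by linarith
      then have "2 * C2 * K1 * K2 * L n ^ 3 * T / (a n)\<^sup>2 \<le> a n / (2 * (L n + 1))"
        using an L by (simp add: field_simps power2_eq_square power3_eq_cube)
      then show ?thesis unfolding T_def by (simp add: mult_ac)
    qed
    finally have bias: "h n * (inverse (min_pos_eigenvalue ((X n)\<^sup>T * X n)) * euclidean_norm (\<theta> n))
        \<le> a n / (2 * (L n + 1))" .
    \<comment> \<open>The factors of \<open>a\<close> cancel against \<open>h\<close>, and
      \<open>L\<^sup>3 / (L + 1)\<^sup>2 \<ge> L / 4\<close> leaves one growing factor, which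
      \<open>L_large\<close> compares with \<open>t + 1\<close>.\<close>
    have exponent: "(t + 1) * ln (N n) \<le> (a n / (2 * (L n + 1)))\<^sup>2 * h n / (2 * \<sigma>\<^sup>2)"
    proof -
      have "(L n + 1)\<^sup>2 \<le> (2 * L n)\<^sup>2" using L by (intro power_mono) auto
      then have L2: "(L n + 1)\<^sup>2 \<le> 4 * (L n)\<^sup>2" by (simp add: power_mult_distrib)
      have "(t + 1) * (8 * \<sigma>\<^sup>2 * (L n + 1)\<^sup>2) \<le> (t + 1) * (8 * \<sigma>\<^sup>2 * (4 * (L n)\<^sup>2))"
        using L2 t by (intro mult_left_mono) auto
      also have "\<dots> = (32 * \<sigma>\<^sup>2 * (t + 1)) * (L n)\<^sup>2" by simp
      also have "\<dots> \<le> (C2 * L n) * (L n)\<^sup>2"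
        using L(2) C2 by (intro mult_right_mono) (simp_all add: field_simps)
      also have "\<dots> = C2 * L n ^ 3" by (simp add: power2_eq_square power3_eq_cube)
      finally have "(t + 1) \<le> C2 * L n ^ 3 / (8 * \<sigma>\<^sup>2 * (L n + 1)\<^sup>2)"
        using sigma L by (subst pos_le_divide_eq) auto
      then have "(t + 1) * ln (N n) \<le> C2 * L n ^ 3 / (8 * \<sigma>\<^sup>2 * (L n + 1)\<^sup>2) * ln (N n)"
        using N by (intro mult_right_mono) auto
      also have "\<dots> = (a n / (2 * (L n + 1)))\<^sup>2 * h n / (2 * \<sigma>\<^sup>2)"
      proof -
        have "(2 * (L n + 1))\<^sup>2 = 4 * (L n + 1)\<^sup>2" unfolding power_mult_distrib by simp
        then show ?thesis unfolding hn power_divide using an by simp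
      qed
      finally show ?thesis .
    qed
    have uL: "u n = 1 + inverse (L n)" unfolding u L_def ..
    have "\<bar>1 - measure (M n)
            {\<omega> \<in> space (M n).
               large_components (\<theta> n) (a n * u n) \<subseteq> large_components (\<theta>hat n \<omega>) (a n) \<and>
               large_components (\<theta>hat n \<omega>) (a n) \<subseteq> large_components (\<theta> n) (a n / u n)}\<bar>
        \<le> 2 * real (p n) * exp (- (a n / (2 * (L n + 1)))\<^sup>2 * h n / (2 * \<sigma>\<^sup>2))"
      unfolding theta_hat y uL
      using n L
      by (intro ridge_threshold_error_bound prob sigma normal indep X beta theta h_pos an bias) auto
    \<comment> \<open>The union bound costs a factor \<open>N n\<close>, which is why the exponent
      was prepared for \<open>t + 1\<close>.\<close>
    also have "\<dots> \<le> 2 * N n * exp (- ((t + 1) * ln (N n)))"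
      using N exponent by (intro mult_mono) auto
    also have "\<dots> = 2 * N n powr (- t)"
    proof -
      have "N n * exp (- ((t + 1) * ln (N n))) = exp (ln (N n) + - ((t + 1) * ln (N n)))"
        using N by (simp only: exp_add exp_ln)
      also have "ln (N n) + - ((t + 1) * ln (N n)) = - t * ln (N n)" by (simp add: algebra_simps)
      finally show ?thesis using N by (simp add: powr_def)
    qed
    finally show ?case .
  qed
  then show ?thesis
    unfolding N_def by (intro landau_o.bigI[of 2]) auto
qed

end
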